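(* Let $c\geq 0$ be fixed. For $n\in\mathbb{N}$ let the barbell $B(n,c)$ be the graph obtained from two complete graphs $K_{\lfloor cn\rfloor}$ joined by a path $P_n$ on $n$ vertices, one end of the path being a vertex of the first clique and the other end a vertex of the second clique. Then \[\mathrm{dct}(B(n,c))=(1+o(1))\frac{n}{2}\cdot\frac{1+4c}{2+4c},\] and the cost of drunkenness is \[F(B(n,c))=\frac{\mathrm{ct}(B(n,c))}{\mathrm{dct}(B(n,c))}=1+\frac{1}{1+4c}+o(1),\] where asymptotics are as $n\to\infty$.
   Context: Cops and robber game on a finite connected graph $G=(V,E)$ with $k$ cops: in round $0$ the cops choose positions $x\in V^k$, then the robber chooses his initial vertex; in each round $t\ge1$ first each cop moves along an edge or stays, then the robber moves. Capture time is the first time a cop and the robber occupy the same vertex. The cop number $c(G)$ is the minimum $k$ for which the cops can guarantee capture of a robber who sees everything and plays optimally ($c(B(n,c))=1$). $\mathrm{ct}_{x,y}(G,k)$ is the capture time from $(x,y)$ under optimal play (cops minimizing, robber maximizing); $\mathrm{ct}(G,k)=\min_{x}\max_{y}\mathrm{ct}_{x,y}(G,k)$ and $\mathrm{ct}(G)=\mathrm{ct}(G,c(G))$. In the drunk robber version, after the cops choose $x$ the robber's initial vertex is uniformly random in $V$, and in each round the robber moves to a uniformly random neighbour of his current vertex (open neighbourhood; he never stays), independently of the cops; the cops see him. $\mathrm{dct}_{x,y}(G,k)$ is the expected capture time from $(x,y)$ when the cops play to minimize it, $\mathrm{dct}(G,k)=\min_{x\in V^k}\frac{1}{|V|}\sum_{y\in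 V}\mathrm{dct}_{x,y}(G,k)$, $\mathrm{dct}(G)=\mathrm{dct}(G,c(G))$, and $F(G)=\mathrm{ct}(G)/\mathrm{dct}(G)$. *)

theory Defs
  imports "HOL-Probability.Probability" "HOL-Library.Landau_Symbols"
begin

section \<open>Graphs and the barbell\<close>

record 'a ugraph =
  verts :: "'a set"
  edges :: "'a set set"

definition nbrs :: "'a ugraph \<Rightarrow> 'a \<Rightarrow> 'a set" where
  "nbrs G v = {w. v \<noteq> w \<and> {v, w} \<in> edges G}"

definition complete_edges :: "'a set \<Rightarrow> 'a set set" where
  "complete_edges A = {{u, v} | u v. u \<in> A \<and> v \<in> A \<and> u \<noteq> v}"

text \<open>The path occupies \<open>0, \<dots>, n - 1\<close>; with \<open>m = \<lfloor>c n\<rfloor>\<close>, the left clique consists of the \<open>m\<close>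
  integers ending at \<open>0\<close> and the right clique of the \<open>m\<close> integers starting at \<open>n - 1\<close>. So each end
  of the path is also a vertex of a clique, and if \<open>m = 0\<close> the graph is just the path.\<close>

definition barbell :: "nat \<Rightarrow> real \<Rightarrow> int ugraph" where
  "barbell n c =
    (let m = \<lfloor>c * real n\<rfloor>;
         L = {1 - m..0};
         P = {0..int n - 1};
         R = {int n - 1..int n + m - 2}
     in \<lparr>verts = L \<union> P \<union> R,
         edges = complete_edges L \<union> {{i, i + 1} | i. i \<in> P \<and> i + 1 \<in> P} \<union> complete_edges R\<rparr>)"


section \<open>Cops\<close>

text \<open>Positions of \<open>k\<close> cops are lists of length \<open>k\<close>.\<close>

definition cop_positions :: "'a ugraph \<Rightarrow> nat \<Rightarrow> 'a list set" where
  "cop_positions G k = {x. length x = k \<and> set x \<subseteq> verts G}"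

definition cop_move :: "'a ugraph \<Rightarrow> 'a list \<Rightarrow> 'a list \<Rightarrow> bool" where
  "cop_move G x x' \<longleftrightarrow> list_all2 (\<lambda>u v. v = u \<or> v \<in> nbrs G u) x x'"

text \<open>A strategy maps the robber's past positions \<open>[r 0, \<dots>, r (t - 1)]\<close> to the cops' positions after
  their move in round \<open>t\<close>; for \<open>t = 0\<close> these are the initial positions. The cops' own past positions
  are determined by the strategy and this history.\<close>

definition cop_strategies :: "'a ugraph \<Rightarrow> 'a list \<Rightarrow> ('a list \<Rightarrow> 'a list) set" where
  "cop_strategies G x = {\<sigma>. \<sigma> [] = x \<and> (\<forall>h r. cop_move G (\<sigma> h) (\<sigma> (h @ [r])))}"

definition cops_at :: "('a list \<Rightarrow> 'a list) \<Rightarrow> (nat \<Rightarrow> 'a) \<Rightarrow> nat \<Rightarrow> 'a list" where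
  "cops_at \<sigma> r t = \<sigma> (map r [0..<t])"

text \<open>In a round \<open>t \<ge> 1\<close> the robber, still at \<open>r (t - 1)\<close>, may be caught by the cops' move, or he may
  meet a cop by his own move to \<open>r t\<close>.\<close>

definition captured_in_round :: "('a list \<Rightarrow> 'a list) \<Rightarrow> (nat \<Rightarrow> 'a) \<Rightarrow> nat \<Rightarrow> bool" where
  "captured_in_round \<sigma> r t \<longleftrightarrow>
     (t \<ge> 1 \<and> r (t - 1) \<in> set (cops_at \<sigma> r t)) \<or> r t \<in> set (cops_at \<sigma> r t)"

definition capture_time :: "('a list \<Rightarrow> 'a list) \<Rightarrow> (nat \<Rightarrow> 'a) \<Rightarrow> enat" where
  "capture_time \<sigma> r = (INF t \<in> {t. captured_in_round \<sigma> r t}. enat t)"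


section \<open>Adversarial robber\<close>

text \<open>Against a fixed (deterministic) strategy of the cops, the plays arising from robber strategies
  are exactly the plays given by the following trajectories.\<close>

definition robber_plays :: "'a ugraph \<Rightarrow> 'a \<Rightarrow> (nat \<Rightarrow> 'a) set" where
  "robber_plays G y = {r. r 0 = y \<and> (\<forall>t. r (Suc t) = r t \<or> r (Suc t) \<in> nbrs G (r t))}"

definition cops_can_win :: "'a ugraph \<Rightarrow> nat \<Rightarrow> bool" where
  "cops_can_win G k \<longleftrightarrow>
     (\<exists>x \<in> cop_positions G k. \<exists>\<sigma> \<in> cop_strategies G x.
        \<forall>y \<in> verts G. \<forall>r \<in> robber_plays G y. \<exists>t. captured_in_round \<sigma> r t)"

definition cop_number :: "'a ugraph \<Rightarrow> nat" where
  "cop_number G = (LEAST k. cops_can_win G k)"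

definition ct_from :: "'a ugraph \<Rightarrow> 'a list \<Rightarrow> 'a \<Rightarrow> enat" where
  "ct_from G x y = (INF \<sigma> \<in> cop_strategies G x. SUP r \<in> robber_plays G y. capture_time \<sigma> r)"

definition ct_k :: "'a ugraph \<Rightarrow> nat \<Rightarrow> enat" where
  "ct_k G k = (INF x \<in> cop_positions G k. SUP y \<in> verts G. ct_from G x y)"

definition ct :: "'a ugraph \<Rightarrow> enat" where
  "ct G = ct_k G (cop_number G)"


section \<open>Drunk robber\<close>

text \<open>The simple random walk, driven by an i.i.d. sequence of random maps: in each step all vertices
  independently choose a uniformly random neighbour, and the walk moves to the choice of its current
  vertex. Its law is confirmed by \<open>emeasure_drunk_walk_cylinder\<close> below.\<close>

definition drunk_choices :: "'a ugraph \<Rightarrow> ('a \<Rightarrow> 'a) stream measure" where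
  "drunk_choices G =
     stream_space (measure_pmf (Pi_pmf (verts G) undefined (\<lambda>v. pmf_of_set (nbrs G v))))"

primrec drunk_walk :: "'a \<Rightarrow> ('a \<Rightarrow> 'a) stream \<Rightarrow> nat \<Rightarrow> 'a" where
  "drunk_walk y \<omega> 0 = y"
| "drunk_walk y \<omega> (Suc t) = (\<omega> !! t) (drunk_walk y \<omega> t)"

text \<open>Countability of the vertex type makes the walk and the capture time measurable.\<close>

definition dct_from :: "'a::countable ugraph \<Rightarrow> 'a list \<Rightarrow> 'a \<Rightarrow> ennreal" where
  "dct_from G x y =
     (INF \<sigma> \<in> cop_strategies G x.
        \<integral>\<^sup>+ \<omega>. ennreal_of_enat (capture_time \<sigma> (drunk_walk y \<omega>)) \<partial>drunk_choices G)"

definition dct_k :: "'a::countable ugraph \<Rightarrow> nat \<Rightarrow> ennreal" where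
  "dct_k G k =
     (INF x \<in> cop_positions G k. (\<Sum>y \<in> verts G. dct_from G x y) / of_nat (card (verts G)))"

definition dct :: "'a::countable ugraph \<Rightarrow> ennreal" where
  "dct G = dct_k G (cop_number G)"

text \<open>When passing to reals, \<open>enn2real\<close> sends \<open>\<infinity>\<close> to \<open>0\<close>; asymptotics with positive leading term
  therefore entail eventual finiteness.\<close>

definition cost_of_drunkenness :: "'a::countable ugraph \<Rightarrow> ennreal" where
  "cost_of_drunkenness G = ennreal_of_enat (ct G) / dct G"


section \<open>Sanity checks\<close>

lemma card_verts_barbell:
  assumes "n \<ge> 1" "\<lfloor>c * real n\<rfloor> \<ge> 1"
  shows "int (card (verts (barbell n c))) = int n + 2 * \<lfloor>c * real n\<rfloor> - 2"
proof -
  define m where "m = \<lfloor>c * real n\<rfloor>"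
  have "m \<ge> 1" using assms by (simp add: m_def)
  then have "verts (barbell n c) = {1 - m..int n + m - 2}"
    using \<open>n \<ge> 1\<close> unfolding barbell_def Let_def m_def[symmetric] by auto
  then show ?thesis using \<open>m \<ge> 1\<close> \<open>n \<ge> 1\<close> unfolding m_def[symmetric] by simp
qed

lemma prob_space_drunk_choices: "prob_space (drunk_choices G)"
  unfolding drunk_choices_def
  by (intro prob_space.prob_space_stream_space prob_space_measure_pmf)

lemma measurable_drunk_walk:
  fixes G :: "'a::countable ugraph"
  shows "(\<lambda>\<omega>. drunk_walk y \<omega> t) \<in> measurable (drunk_choices G) (count_space UNIV)"
proof (induction t)
  case (Suc t)
  have "(\<lambda>\<omega>. (\<omega> !! t) v) \<in> measurable (drunk_choices G) (count_space UNIV)" for v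
    unfolding drunk_choices_def
    by (rule measurable_compose[OF measurable_snth]) simp
  from measurable_compose_countable[OF this Suc] show ?case by simp
qed simp

lemma measurable_capture_time:
  fixes G :: "'a::countable ugraph"
  shows "(\<lambda>\<omega>. ennreal_of_enat (capture_time \<sigma> (drunk_walk y \<omega>))) \<in> borel_measurable (drunk_choices G)"
proof -
  have hist: "(\<lambda>\<omega>. map (drunk_walk y \<omega>) [0..<t]) \<in> measurable (drunk_choices G) (count_space UNIV)"
    for t
  proof (induction t)
    case (Suc t)
    have "(\<lambda>\<omega>. (\<lambda>h. h @ [drunk_walk y \<omega> t]) (map (drunk_walk y \<omega>) [0..<t]))
        \<in> measurable (drunk_choices G) (count_space UNIV)"
      by (rule measurable_compose_countable[OF _ Suc])
         (rule measurable_compose[OF measurable_drunk_walk], simp)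
    then show ?case by simp
  qed simp
  have ev: "Measurable.pred (drunk_choices G) (\<lambda>\<omega>. captured_in_round \<sigma> (drunk_walk y \<omega>) t)" for t
  proof -
    have in_cops: "Measurable.pred (drunk_choices G)
        (\<lambda>\<omega>. drunk_walk y \<omega> s \<in> set (\<sigma> (map (drunk_walk y \<omega>) [0..<t])))" for s
      by (rule measurable_compose_countable[OF _ hist])
         (rule measurable_compose[OF measurable_drunk_walk], simp)
    show ?thesis
      unfolding captured_in_round_def cops_at_def
      by (intro pred_intros_logic in_cops) simp
  qed
  have "capture_time \<sigma> r = (INF t. if captured_in_round \<sigma> r t then enat t else \<infinity>)" for r
    unfolding capture_time_def
  proof (intro antisym INF_greatest)
    fix t assume "t \<in> {t. captured_in_round \<sigma> r t}"
    then show "(INF t. if captured_in_round \<sigma> r t then enat t else \<infinity>) \<le> enat t"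
      by (intro INF_lower2[of t]) auto
  qed (auto intro: INF_lower)
  moreover have "(\<lambda>\<omega>. INF t. if captured_in_round \<sigma> (drunk_walk y \<omega>) t then enat t else \<infinity>)
      \<in> measurable (drunk_choices G) (count_space UNIV)"
    using ev by (intro measurable_INF) (auto intro!: measurable_If)
  ultimately have "(\<lambda>\<omega>. capture_time \<sigma> (drunk_walk y \<omega>))
      \<in> measurable (drunk_choices G) (count_space UNIV)" by simp
  then show ?thesis by (rule measurable_compose) simp
qed

lemma drunk_walk_Stream: "drunk_walk y (f ## \<omega>) (Suc t) = drunk_walk (f y) \<omega> t"
  by (induction t) simp_all

lemma emeasure_drunk_walk_cylinder:
  fixes G :: "'a::countable ugraph"
  assumes fin: "finite (verts G)"
    and nbrs: "\<And>v. v \<in> verts G \<Longrightarrow> nbrs G v \<noteq> {} \<and> nbrs G v \<subseteq> verts G"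
    and p: "\<And>i. i \<le> t \<Longrightarrow> p i \<in> verts G"
  shows "emeasure (drunk_choices G)
           {\<omega> \<in> space (drunk_choices G). \<forall>i\<le>t. drunk_walk (p 0) \<omega> i = p i} =
         (\<Prod>i<t. if p (Suc i) \<in> nbrs G (p i) then 1 / of_nat (card (nbrs G (p i))) else 0)"
  using p
proof (induction t arbitrary: p)
  case 0
  then show ?case
    using prob_space.emeasure_space_1[OF prob_space_drunk_choices[of G]] by simp
next
  case (Suc t)
  let ?\<mu> = "Pi_pmf (verts G) undefined (\<lambda>v. pmf_of_set (nbrs G v))"
  let ?w = "\<lambda>u v. if v \<in> nbrs G u then 1 / of_nat (card (nbrs G u)) else 0 :: ennreal"
  let ?A = "{\<omega> \<in> space (drunk_choices G). \<forall>i\<le>Suc t. drunk_walk (p 0) \<omega> i = p i}"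
  let ?B = "{\<omega> \<in> space (drunk_choices G). \<forall>i\<le>t. drunk_walk (p 1) \<omega> i = p (Suc i)}"
  have sp: "space (drunk_choices G) = UNIV"
    by (simp add: drunk_choices_def space_stream_space)
  have A: "?A \<in> sets (drunk_choices G)"
  proof -
    have "Measurable.pred (drunk_choices G) (\<lambda>\<omega>. drunk_walk (p 0) \<omega> i = p i)" for i
      using measurable_compose[OF measurable_drunk_walk, of "\<lambda>v. v = p i" "count_space UNIV"]
      by simp
    then have "Measurable.pred (drunk_choices G) (\<lambda>\<omega>. \<forall>i\<in>{..Suc t}. drunk_walk (p 0) \<omega> i = p i)"
      by (rule pred_intros_finite(3)[OF finite_atMost])
    then show ?thesis unfolding pred_def Ball_def atMost_iff .
  qed
  have all: "(\<forall>i\<le>Suc t. Q i) \<longleftrightarrow> Q 0 \<and> (\<forall>i\<le>t. Q (Suc i))" for Q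
  proof (intro iffI conjI allI impI)
    fix i assume "Q 0 \<and> (\<forall>i\<le>t. Q (Suc i))" "i \<le> Suc t"
    then show "Q i" by (cases i) simp_all
  qed simp_all
  have step: "{\<omega>. f ## \<omega> \<in> ?A} = (if f (p 0) = p 1 then ?B else {})" for f
  proof (cases "f (p 0) = p 1")
    case True
    then show ?thesis unfolding all sp by (simp add: drunk_walk_Stream del: drunk_walk.simps(2))
  next
    case False
    then have "\<not> (\<forall>i\<le>t. drunk_walk (f (p 0)) \<omega> i = p (Suc i))" for \<omega> by force
    then show ?thesis using False unfolding all sp by (simp add: drunk_walk_Stream del: drunk_walk.simps(2))
  qed
  have p0: "p 0 \<in> verts G" using Suc.prems by simp
  have fin_nbrs: "finite (nbrs G (p 0))" using fin nbrs[OF p0] finite_subset by blast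
  have "emeasure (drunk_choices G) ?A =
      (\<integral>\<^sup>+ f. emeasure (drunk_choices G) {\<omega> \<in> space (drunk_choices G). f ## \<omega> \<in> ?A} \<partial>?\<mu>)"
    using A unfolding drunk_choices_def
    by (subst prob_space.emeasure_stream_space[OF prob_space_measure_pmf]) (simp_all add: space_stream_space)
  also have "\<dots> = (\<integral>\<^sup>+ f. emeasure (drunk_choices G) ?B * indicator {f. f (p 0) = p 1} f \<partial>?\<mu>)"
  proof (rule nn_integral_cong)
    fix f
    have "{\<omega> \<in> space (drunk_choices G). f ## \<omega> \<in> ?A} = {\<omega>. f ## \<omega> \<in> ?A}"
      unfolding sp by (simp only: UNIV_I simp_thms)
    then show "emeasure (drunk_choices G) {\<omega> \<in> space (drunk_choices G). f ## \<omega> \<in> ?A} =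
        emeasure (drunk_choices G) ?B * indicator {f. f (p 0) = p 1} f"
      by (simp only: step) (simp only: indicator_def mem_Collect_eq if_distrib emeasure_empty split: if_split, simp)
  qed
  also have "\<dots> = emeasure (drunk_choices G) ?B * emeasure ?\<mu> {f. f (p 0) = p 1}"
    by (simp add: nn_integral_cmult)
  also have "emeasure ?\<mu> {f. f (p 0) = p 1} = emeasure (map_pmf (\<lambda>f. f (p 0)) ?\<mu>) {p 1}"
    by (simp add: vimage_def)
  also have "\<dots> = pmf (pmf_of_set (nbrs G (p 0))) (p 1)"
    using p0 fin by (simp add: Pi_pmf_component emeasure_pmf_single)
  also have "\<dots> = ?w (p 0) (p 1)"
  proof -
    have "card (nbrs G (p 0)) > 0" using nbrs[OF p0] fin_nbrs by (simp add: card_gt_0_iff)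
    then have "ennreal (1 / card (nbrs G (p 0))) = 1 / of_nat (card (nbrs G (p 0)))"
      using divide_ennreal[of 1 "card (nbrs G (p 0))"] by (simp add: ennreal_of_nat_eq_real_of_nat)
    then show ?thesis using nbrs[OF p0] fin_nbrs by simp
  qed
  also have "emeasure (drunk_choices G) ?B = (\<Prod>i<t. ?w (p (Suc i)) (p (Suc (Suc i))))"
    using Suc.IH[of "\<lambda>i. p (Suc i)"] Suc.prems by simp
  finally show ?case
    by (simp add: prod.lessThan_Suc_shift mult.commute del: prod.lessThan_Suc)
qed

end

theory Submission
  imports Defs "HOL-Real_Asymp.Real_Asymp"
begin

text \<open>Collapse each clique to its end of the path. The collapsed random walk is driftless in the interior
  and reflecting at the ends, so by Kolmogorov's inequality it moves only \<open>o(n)\<close> within \<open>n\<close> rounds,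
  except with probability \<open>o(1)\<close>. The collapsed cop moves at unit speed, hence no strategy is faster
  than the collapsed distance up to \<open>o(n)\<close>. Conversely a cop who starts in the middle of the path and
  chases the robber needs only this distance up to \<open>o(n)\<close>, and never more than \<open>n / 2 + 1\<close> rounds, which
  controls the exceptional event. It remains to average the distance over the initial vertex.\<close>

section \<open>The barbell\<close>

text \<open>The vertices are integers in a row, so collapsing the cliques is truncation to the path.
  The obstacle is that a strategy may react to the robber in any way; both bounds are therefore
  pathwise, and randomness enters only through the probability that the robber strays. The constant
  is the mean distance to the middle: asymptotically a fraction 1 / (1 + 2c) of the vertices is on
  the path, at mean distance n / 4, and the remaining 2c / (1 + 2c) sits at collapsed distance n /
  2, together n (1/4 + c) / (1 + 2c). An adversarial robber simply waits at distance n / 2, and the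
  quotient of the two is (2 + 4c) / (1 + 4c) = 1 + 1 / (1 + 4c).\<close>

definition clamp :: "nat \<Rightarrow> int \<Rightarrow> int" where
  "clamp n v = max 0 (min (int n - 1) v)"

text \<open>The number of vertices that each clique has off the path. The cutoff at 0 merges the
  empty clique with the one-vertex clique, which give the same graph, the bare path.\<close>

definition clique_excess :: "nat \<Rightarrow> real \<Rightarrow> int" where
  "clique_excess n c = max 0 (\<lfloor>c * real n\<rfloor> - 1)"

lemma clique_excess_nonneg: "clique_excess n c \<ge> 0"
  by (simp add: clique_excess_def)

lemma verts_barbell:
  assumes "n \<ge> 1"
  shows "verts (barbell n c) = {- clique_excess n c..int n - 1 + clique_excess n c}"
  using assms unfolding barbell_def Let_def clique_excess_def by auto

lemma mem_nbrs_barbell: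
  assumes "n \<ge> 1"
  shows "w \<in> nbrs (barbell n c) v \<longleftrightarrow> v \<noteq> w \<and>
     (v \<in> {- clique_excess n c..0} \<and> w \<in> {- clique_excess n c..0} \<or>
      \<bar>v - w\<bar> = 1 \<and> v \<in> {0..int n - 1} \<and> w \<in> {0..int n - 1} \<or>
      v \<in> {int n - 1..int n - 1 + clique_excess n c} \<and> w \<in> {int n - 1..int n - 1 + clique_excess n c})"
proof -
  have ce: "{v, w} \<in> complete_edges A \<longleftrightarrow> v \<noteq> w \<and> v \<in> A \<and> w \<in> A" for A :: "int set"
    unfolding complete_edges_def by (auto simp: doubleton_eq_iff)
  have pe: "{v, w} \<in> {{i, i + 1} | i. i \<in> P \<and> i + 1 \<in> P} \<longleftrightarrow> \<bar>v - w\<bar> = 1 \<and> v \<in> P \<and> w \<in> P"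
    (is "?l = ?r") for P :: "int set"
  proof
    assume ?l
    then obtain i where i: "{v, w} = {i, i + 1}" "i \<in> P" "i + 1 \<in> P" by blast
    from i(1) have "v = i \<and> w = i + 1 \<or> v = i + 1 \<and> w = i" by (simp add: doubleton_eq_iff)
    then show ?r using i(2,3) by (elim disjE) simp_all
  next
    assume ?r
    then have "w = v + 1 \<or> v = w + 1" by arith
    then have "{v, w} = {min v w, min v w + 1} \<and> min v w \<in> P \<and> min v w + 1 \<in> P"
      using \<open>?r\<close> by (elim disjE) (simp_all add: insert_commute)
    then show ?l by blast
  qed
  define m where "m = \<lfloor>c * real n\<rfloor>"
  have E: "edges (barbell n c) = complete_edges {1 - m..0} \<union>
      {{i, i + 1} | i. i \<in> {0..int n - 1} \<and> i + 1 \<in> {0..int n - 1}} \<union>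
      complete_edges {int n - 1..int n + m - 2}"
    by (simp only: barbell_def Let_def m_def ugraph.select_convs)
  have a: "clique_excess n c = max 0 (m - 1)"
    by (simp add: clique_excess_def m_def)
  \<comment> \<open>When the clique is empty the two intervals differ, the second being {0}; then
    \<open>v \<noteq> w\<close> makes both sides false.\<close>
  have left: "v \<noteq> w \<and> v \<in> {1 - m..0} \<and> w \<in> {1 - m..0} \<longleftrightarrow>
      v \<noteq> w \<and> v \<in> {- clique_excess n c..0} \<and> w \<in> {- clique_excess n c..0}"
    unfolding a atLeastAtMost_iff by linarith
  have right: "v \<noteq> w \<and> v \<in> {int n - 1..int n + m - 2} \<and> w \<in> {int n - 1..int n + m - 2} \<longleftrightarrow>
      v \<noteq> w \<and> v \<in> {int n - 1..int n - 1 + clique_excess n c} \<and>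
      w \<in> {int n - 1..int n - 1 + clique_excess n c}"
    unfolding a atLeastAtMost_iff by linarith
  have "{v, w} \<in> edges (barbell n c) \<longleftrightarrow>
      v \<noteq> w \<and> v \<in> {- clique_excess n c..0} \<and> w \<in> {- clique_excess n c..0} \<or>
      \<bar>v - w\<bar> = 1 \<and> v \<in> {0..int n - 1} \<and> w \<in> {0..int n - 1} \<or>
      v \<noteq> w \<and> v \<in> {int n - 1..int n - 1 + clique_excess n c} \<and>
      w \<in> {int n - 1..int n - 1 + clique_excess n c}"
    unfolding E Un_iff ce pe left right by blast
  then show ?thesis
    unfolding nbrs_def mem_Collect_eq by blast
qed

lemma nbrs_barbell_subset:
  assumes "n \<ge> 1"
  shows "nbrs (barbell n c) v \<subseteq> verts (barbell n c)"
  using clique_excess_nonneg[of n c] assms by (auto simp: mem_nbrs_barbell verts_barbell)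

lemma nbrs_barbell_nonempty:
  assumes "n \<ge> 2" "v \<in> verts (barbell n c)"
  shows "nbrs (barbell n c) v \<noteq> {}"
proof -
  have "(if v < 0 then 0 else if v > int n - 1 then int n - 1 else if v = 0 then 1 else v - 1)
      \<in> nbrs (barbell n c) v"
    using assms clique_excess_nonneg[of n c] by (auto simp: mem_nbrs_barbell verts_barbell)
  then show ?thesis by blast
qed

lemma finite_verts_barbell: "n \<ge> 1 \<Longrightarrow> finite (verts (barbell n c))"
  by (simp add: verts_barbell)

lemma finite_nbrs_barbell: "n \<ge> 1 \<Longrightarrow> finite (nbrs (barbell n c) v)"
  using finite_subset[OF nbrs_barbell_subset finite_verts_barbell] .

section \<open>The collapse as a map to the path\<close>

lemma clamp_lipschitz:
  assumes "n \<ge> 1" "w \<in> nbrs (barbell n c) v"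
  shows "\<bar>clamp n w - clamp n v\<bar> \<le> 1"
  using assms by (auto simp: mem_nbrs_barbell clamp_def)

lemma clamp_bounds: "n \<ge> 1 \<Longrightarrow> 0 \<le> clamp n v \<and> clamp n v \<le> int n - 1"
  by (auto simp: clamp_def)

text \<open>In the interior the two neighbours give equality, as (d - 1)^2 + (d + 1)^2 = 2 (d^2 +
  1). Elsewhere the bound holds for each neighbour: a step off an end turns the offset d from
  \<open>a\<close> into d - 1, where (d - 1)^2 = d^2 + 1 - 2d, and d >= 0 because \<open>a\<close>
  lies on the path.\<close>

lemma sum_nbrs_sq_le:
  assumes "n \<ge> 2" "v \<in> verts (barbell n c)" "0 \<le> a" "a \<le> int n - 1"
  shows "(\<Sum>w\<in>nbrs (barbell n c) v. (clamp n w - a)\<^sup>2)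
           \<le> int (card (nbrs (barbell n c) v)) * ((clamp n v - a)\<^sup>2 + 1)"
proof (cases "0 < v \<and> v < int n - 1")
  case True
  then have "nbrs (barbell n c) v = {v - 1, v + 1}"
    by (auto simp: mem_nbrs_barbell)
  moreover have "clamp n v = v" "clamp n (v - 1) = v - 1" "clamp n (v + 1) = v + 1"
    using True by (auto simp: clamp_def)
  moreover have "(v - 1 - a)\<^sup>2 + (v + 1 - a)\<^sup>2 = 2 * ((v - a)\<^sup>2 + 1)"
    by (simp add: power2_eq_square algebra_simps)
  ultimately show ?thesis by simp
next
  case False
  have "(clamp n w - a)\<^sup>2 \<le> (clamp n v - a)\<^sup>2 + 1" if w: "w \<in> nbrs (barbell n c) v" for w
  proof -
    from False w \<open>n \<ge> 2\<close> have
      "clamp n w = clamp n v \<or> clamp n v = 0 \<and> clamp n w = 1 \<or>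
       clamp n v = int n - 1 \<and> clamp n w = int n - 2"
      by (auto simp: mem_nbrs_barbell clamp_def)
    then show ?thesis
    proof (elim disjE conjE)
      assume "clamp n v = int n - 1" "clamp n w = int n - 2"
      moreover have "(int n - 2 - a)\<^sup>2 = (int n - 1 - a)\<^sup>2 + 1 - 2 * (int n - 1 - a)"
        by (simp add: power2_eq_square algebra_simps)
      ultimately show ?thesis using assms by simp
    qed (use assms in \<open>auto simp: power2_eq_square algebra_simps\<close>)
  qed
  then have "(\<Sum>w\<in>nbrs (barbell n c) v. (clamp n w - a)\<^sup>2)
      \<le> (\<Sum>w\<in>nbrs (barbell n c) v. (clamp n v - a)\<^sup>2 + 1)" by (rule sum_mono)
  then show ?thesis by simp
qed


section \<open>Displacement of the random walk\<close>

lemma space_drunk_choices: "space (drunk_choices G) = UNIV"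
  by (simp add: drunk_choices_def space_stream_space)

lemma sets_exists_drunk_walk:
  fixes G :: "'a::countable ugraph"
  shows "{\<omega>. \<exists>s\<le>t. P (drunk_walk y \<omega> s)} \<in> sets (drunk_choices G)"
proof -
  have "Measurable.pred (drunk_choices G) (\<lambda>\<omega>. P (drunk_walk y \<omega> s))" for s
    using measurable_compose[OF measurable_drunk_walk, of P "count_space UNIV"] by simp
  then have "Measurable.pred (drunk_choices G) (\<lambda>\<omega>. \<exists>s\<in>{..t}. P (drunk_walk y \<omega> s))"
    by (rule pred_intros_finite(4)[OF finite_atMost])
  then show ?thesis by (simp add: pred_def space_drunk_choices Bex_def)
qed

text \<open>Kolmogorov's inequality: away from the path's ends the clamped walk is a martingale with unit
  steps, while at the ends it can only move towards \<open>a\<close>, unless it is there already.\<close>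

lemma displacement_bound:
  assumes "n \<ge> 2" "y \<in> verts (barbell n c)" "0 \<le> a" "a \<le> int n - 1" "L > 0"
  shows "emeasure (drunk_choices (barbell n c))
           {\<omega>. \<exists>s\<le>t. real_of_int \<bar>clamp n (drunk_walk y \<omega> s) - a\<bar> \<ge> L}
         \<le> ennreal ((real_of_int ((clamp n y - a)\<^sup>2) + real t) / L\<^sup>2)"
  using assms(2)
\<comment> \<open>Conditioning on the first step replaces a stopping time: squared distance plus
  remaining rounds does not grow in the mean, and the walk is stopped once the distance reaches
  \<open>L\<close>.\<close>
proof (induction t arbitrary: y)
  case (0 y)
  show ?case
  proof (cases "real_of_int \<bar>clamp n y - a\<bar> \<ge> L")
    case True
    then have "L\<^sup>2 \<le> (real_of_int \<bar>clamp n y - a\<bar>)\<^sup>2" using \<open>L > 0\<close> by (intro power_mono) auto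
    then have "1 \<le> real_of_int ((clamp n y - a)\<^sup>2) / L\<^sup>2" using \<open>L > 0\<close> by simp
    then show ?thesis using True prob_space.emeasure_space_1[OF prob_space_drunk_choices[of "barbell n c"]]
      by (simp add: space_drunk_choices)
  qed simp
next
  case (Suc t y)
  let ?G = "barbell n c"
  let ?\<mu> = "Pi_pmf (verts ?G) undefined (\<lambda>v. pmf_of_set (nbrs ?G v))"
  let ?A = "\<lambda>t y. {\<omega>. \<exists>s\<le>t. real_of_int \<bar>clamp n (drunk_walk y \<omega> s) - a\<bar> \<ge> L}"
  have fin: "finite (verts ?G)" "finite (nbrs ?G y)"
    using assms finite_verts_barbell finite_nbrs_barbell by auto
  have ne: "nbrs ?G y \<noteq> {}" using Suc.prems assms nbrs_barbell_nonempty by blast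
  show ?case
  proof (cases "real_of_int \<bar>clamp n y - a\<bar> \<ge> L")
    case True
    then have "L\<^sup>2 \<le> (real_of_int \<bar>clamp n y - a\<bar>)\<^sup>2" using \<open>L > 0\<close> by (intro power_mono) auto
    then have "1 \<le> (real_of_int ((clamp n y - a)\<^sup>2) + real (Suc t)) / L\<^sup>2" using \<open>L > 0\<close> by simp
    then have "1 \<le> ennreal ((real_of_int ((clamp n y - a)\<^sup>2) + real (Suc t)) / L\<^sup>2)"
      by (subst ennreal_1[symmetric]) (rule ennreal_leI)
    with prob_space.emeasure_le_1[OF prob_space_drunk_choices] show ?thesis
      by (rule order_trans)
  next
    case False
    have ex: "(\<exists>s\<le>Suc t. Q s) \<longleftrightarrow> Q 0 \<or> (\<exists>s\<le>t. Q (Suc s))" for Q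
      by (metis Suc_le_mono not0_implies_Suc zero_le)
    \<comment> \<open>Time 0 does not trigger the event, so it becomes the event for the walk
      restarted at \<open>f y\<close> with one round less.\<close>
    have step: "{\<omega>. f ## \<omega> \<in> ?A (Suc t) y} = ?A t (f y)" for f
      using False by (simp add: ex drunk_walk_Stream del: drunk_walk.simps(2))
    have "emeasure (drunk_choices ?G) (?A (Suc t) y) =
        (\<integral>\<^sup>+ f. emeasure (drunk_choices ?G) {\<omega> \<in> space (drunk_choices ?G). f ## \<omega> \<in> ?A (Suc t) y} \<partial>?\<mu>)"
      using sets_exists_drunk_walk[of "Suc t" "\<lambda>v. real_of_int \<bar>clamp n v - a\<bar> \<ge> L" y ?G]
      unfolding drunk_choices_def
      by (subst prob_space.emeasure_stream_space[OF prob_space_measure_pmf]) (simp_all add: space_stream_space)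
    also have "\<dots> = (\<integral>\<^sup>+ f. emeasure (drunk_choices ?G) (?A t (f y)) \<partial>?\<mu>)"
      using step by (simp add: space_drunk_choices)
    also have "\<dots> = (\<integral>\<^sup>+ v. emeasure (drunk_choices ?G) (?A t v) \<partial>map_pmf (\<lambda>f. f y) ?\<mu>)"
      by simp
    also have "map_pmf (\<lambda>f. f y) ?\<mu> = pmf_of_set (nbrs ?G y)"
      using Suc.prems fin by (simp add: Pi_pmf_component)
    also have "(\<integral>\<^sup>+ v. emeasure (drunk_choices ?G) (?A t v) \<partial>pmf_of_set (nbrs ?G y)) =
        (\<Sum>v\<in>nbrs ?G y. emeasure (drunk_choices ?G) (?A t v)) / of_nat (card (nbrs ?G y))"
      using fin ne by (simp add: nn_integral_pmf_of_set)
    also have "\<dots> \<le> (\<Sum>v\<in>nbrs ?G y. ennreal ((real_of_int ((clamp n v - a)\<^sup>2) + real t) / L\<^sup>2))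
        / of_nat (card (nbrs ?G y))"
      using nbrs_barbell_subset[of n c y] assms(1)
      by (intro divide_right_mono_ennreal sum_mono Suc.IH) auto
    also have "\<dots> = ennreal ((\<Sum>v\<in>nbrs ?G y. (real_of_int ((clamp n v - a)\<^sup>2) + real t) / L\<^sup>2)
        / real (card (nbrs ?G y)))"
      using fin ne by (subst sum_ennreal)
        (auto simp: ennreal_of_nat_eq_real_of_nat card_gt_0_iff intro!: divide_ennreal sum_nonneg)
    also have "\<dots> \<le> ennreal ((real_of_int ((clamp n y - a)\<^sup>2) + real (Suc t)) / L\<^sup>2)"
    proof (rule ennreal_leI)
      have "real_of_int (\<Sum>v\<in>nbrs ?G y. (clamp n v - a)\<^sup>2)
          \<le> real_of_int (int (card (nbrs ?G y)) * ((clamp n y - a)\<^sup>2 + 1))"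
        using sum_nbrs_sq_le[OF assms(1) Suc.prems assms(3,4)] by (simp only: of_int_le_iff)
      then have "(\<Sum>v\<in>nbrs ?G y. real_of_int ((clamp n v - a)\<^sup>2) + real t)
          \<le> real (card (nbrs ?G y)) * (real_of_int ((clamp n y - a)\<^sup>2) + real (Suc t))"
        by (simp add: sum.distrib algebra_simps)
      then have "(\<Sum>v\<in>nbrs ?G y. real_of_int ((clamp n v - a)\<^sup>2) + real t) / real (card (nbrs ?G y))
          \<le> real_of_int ((clamp n y - a)\<^sup>2) + real (Suc t)"
        using fin ne by (simp add: divide_le_eq card_gt_0_iff mult.commute)
      then have "(\<Sum>v\<in>nbrs ?G y. real_of_int ((clamp n v - a)\<^sup>2) + real t) / real (card (nbrs ?G y)) / L\<^sup>2
          \<le> (real_of_int ((clamp n y - a)\<^sup>2) + real (Suc t)) / L\<^sup>2"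
        by (rule divide_right_mono) simp
      then show "(\<Sum>v\<in>nbrs ?G y. (real_of_int ((clamp n v - a)\<^sup>2) + real t) / L\<^sup>2) / real (card (nbrs ?G y))
          \<le> (real_of_int ((clamp n y - a)\<^sup>2) + real (Suc t)) / L\<^sup>2"
        by (simp add: sum_divide_distrib[symmetric] mult.commute)
    qed
    finally show ?thesis .
  qed
qed

text \<open>Carries pathwise bounds for all robber plays over to the drunk robber. A null set is
  lost, since a stream may contain maps that do not send vertices to neighbours.\<close>

lemma AE_drunk_walk_plays:
  assumes fin: "finite (verts G)"
    and nbrs: "\<And>v. v \<in> verts G \<Longrightarrow> nbrs G v \<noteq> {} \<and> nbrs G v \<subseteq> verts G"
    and y: "y \<in> verts G"
  shows "AE \<omega> in drunk_choices G. drunk_walk y \<omega> \<in> robber_plays G y"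
proof -
  let ?\<mu> = "Pi_pmf (verts G) undefined (\<lambda>v. pmf_of_set (nbrs G v))"
  have "AE f in ?\<mu>. \<forall>v\<in>verts G. f v \<in> nbrs G v"
  proof (rule AE_pmfI, rule ballI)
    fix f v assume f: "f \<in> set_pmf ?\<mu>" and v: "v \<in> verts G"
    have "f v \<in> set_pmf (map_pmf (\<lambda>f. f v) ?\<mu>)" using f by auto
    also have "map_pmf (\<lambda>f. f v) ?\<mu> = pmf_of_set (nbrs G v)"
      using v fin by (simp add: Pi_pmf_component)
    finally show "f v \<in> nbrs G v"
      using nbrs[OF v] finite_subset[OF _ fin] by auto
  qed
  then have "AE \<omega> in drunk_choices G. stream_all (\<lambda>f. \<forall>v\<in>verts G. f v \<in> nbrs G v) \<omega>"
    unfolding drunk_choices_def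
    by (intro prob_space.AE_stream_all prob_space_measure_pmf) simp_all
  then show ?thesis
  proof eventually_elim
    case (elim \<omega>)
    have "drunk_walk y \<omega> t \<in> verts G" for t
      by (induction t) (use elim nbrs y in \<open>auto simp: sset_range\<close>)
    then show ?case using elim by (auto simp: sset_range robber_plays_def)
  qed
qed


section \<open>Capture times\<close>

lemma capture_time_ge:
  assumes "\<And>t. t < k \<Longrightarrow> \<not> captured_in_round \<sigma> r t"
  shows "enat k \<le> capture_time \<sigma> r"
  unfolding capture_time_def using assms by (intro INF_greatest) (force simp: not_less[symmetric])

lemma capture_time_le:
  assumes "captured_in_round \<sigma> r s" "s \<le> t"
  shows "capture_time \<sigma> r \<le> enat t"
  unfolding capture_time_def using assms by (intro INF_lower2[of s]) auto

text \<open>A strategy is just a map from histories to lists; that it always returns exactly one cop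
  is part of the induction, along with the unit speed of the collapsed cop.\<close>

lemma single_cop_Lipschitz:
  assumes "n \<ge> 1" "\<sigma> \<in> cop_strategies (barbell n c) [x]"
  shows "\<exists>u. \<sigma> h = [u] \<and> \<bar>clamp n u - clamp n x\<bar> \<le> int (length h)"
proof (induction h rule: rev_induct)
  case Nil
  then show ?case using assms by (simp add: cop_strategies_def)
next
  case (snoc r h)
  then obtain u where u: "\<sigma> h = [u]" "\<bar>clamp n u - clamp n x\<bar> \<le> int (length h)" by blast
  have "cop_move (barbell n c) (\<sigma> h) (\<sigma> (h @ [r]))"
    using assms by (simp add: cop_strategies_def)
  then obtain w where w: "\<sigma> (h @ [r]) = [w]" "w = u \<or> w \<in> nbrs (barbell n c) u"
    by (auto simp: cop_move_def u(1) list_all2_Cons1)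
  then have "\<bar>clamp n w - clamp n u\<bar> \<le> 1" using clamp_lipschitz[OF assms(1)] by auto
  then show ?case using u(2) w(1) by simp
qed

text \<open>The cop meets the robber either before or after the robber's move, so the witness is
  \<open>t - 1\<close> or \<open>t\<close>; the form \<open>s \<le> t\<close> covers both.\<close>

lemma captured_imp_dist:
  assumes "n \<ge> 1" "\<sigma> \<in> cop_strategies (barbell n c) [x]" "captured_in_round \<sigma> r t"
  shows "\<exists>s\<le>t. \<bar>clamp n x - clamp n (r s)\<bar> \<le> int t"
proof -
  obtain u where "cops_at \<sigma> r t = [u]" "\<bar>clamp n u - clamp n x\<bar> \<le> int t"
    using single_cop_Lipschitz[OF assms(1,2), of "map r [0..<t]"] by (auto simp: cops_at_def)
  moreover from this have "r (t - 1) = u \<or> r t = u"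
    using assms(3) by (auto simp: captured_in_round_def)
  moreover have "t - 1 \<le> t" by simp
  ultimately show ?thesis by (metis abs_minus_commute order_refl)
qed

text \<open>Triangle inequality: at a capture in round t the cop is within t of his start and the
  robber within \<open>L\<close> of his, so t exceeds the initial distance minus
  \<open>L\<close>.\<close>

lemma capture_time_lower:
  assumes "n \<ge> 1" "\<sigma> \<in> cop_strategies (barbell n c) [x]"
    and small: "\<And>s. s \<le> n \<Longrightarrow> real_of_int \<bar>clamp n (r s) - clamp n y\<bar> < L"
  shows "enat (nat \<lceil>real_of_int \<bar>clamp n x - clamp n y\<bar> - L\<rceil>) \<le> capture_time \<sigma> r"
proof (rule capture_time_ge)
  fix t assume t: "t < nat \<lceil>real_of_int \<bar>clamp n x - clamp n y\<bar> - L\<rceil>"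
  then have t': "real t < real_of_int \<bar>clamp n x - clamp n y\<bar> - L" by linarith
  \<comment> \<open>Collapsed distances are at most n, so every round in question lies in the window
    covered by \<open>small\<close>.\<close>
  have "0 < L" using small[of 0] by linarith
  moreover have "real_of_int \<bar>clamp n x - clamp n y\<bar> \<le> real n"
    using clamp_bounds[OF assms(1), of x] clamp_bounds[OF assms(1), of y] by linarith
  ultimately have "t \<le> n" using t' by linarith
  show "\<not> captured_in_round \<sigma> r t"
  proof
    assume "captured_in_round \<sigma> r t"
    then obtain s where s: "s \<le> t" "\<bar>clamp n x - clamp n (r s)\<bar> \<le> int t"
      using captured_imp_dist[OF assms(1,2)] by blast
    with small[of s] \<open>t \<le> n\<close> t' show False by linarith
  qed
qed

section \<open>The chasing cop\<close>

definition chase_step :: "int ugraph \<Rightarrow> int \<Rightarrow> int \<Rightarrow> int" where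
  "chase_step G u r =
     (if r \<in> nbrs G u then r else if u + sgn (r - u) \<in> nbrs G u then u + sgn (r - u) else u)"

text \<open>Strategies see only the robber's past, so the fold reconstructs the cop's own position
  from it.\<close>

definition chase :: "int ugraph \<Rightarrow> int \<Rightarrow> int list \<Rightarrow> int list" where
  "chase G x h = [foldl (chase_step G) x h]"

text \<open>Legality is demanded for all histories, also those that no robber produces; hence the
  test and the fallback to staying put in \<open>chase_step\<close>.\<close>

lemma chase_in_cop_strategies: "chase G x \<in> cop_strategies G [x]"
  by (auto simp: cop_strategies_def chase_def cop_move_def chase_step_def)

lemma robber_play_verts:
  assumes "n \<ge> 1" "y \<in> verts (barbell n c)" "r \<in> robber_plays (barbell n c) y"
  shows "r t \<in> verts (barbell n c)"
proof (induction t)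
  case (Suc t)
  have "r (Suc t) = r t \<or> r (Suc t) \<in> nbrs (barbell n c) (r t)"
    using assms(3) by (simp add: robber_plays_def)
  then show ?case using Suc nbrs_barbell_subset[OF assms(1), of c "r t"] by auto
qed (use assms in \<open>simp add: robber_plays_def\<close>)

text \<open>The path's vertices are cut vertices, so a robber cannot get past the chasing cop.\<close>

lemma chase_invariant:
  assumes "n \<ge> 2" "y \<in> verts (barbell n c)" "r \<in> robber_plays (barbell n c) y"
    and x: "0 \<le> x" "x \<le> int n - 1"
    and free: "\<And>s. s \<le> t \<Longrightarrow> \<not> captured_in_round (chase (barbell n c) x) r s"
  shows "(cops_at (chase (barbell n c) x) r t = [x + int t] \<and> x + int t \<le> int n - 1 \<and> x + int t < r t) \<or>
    (cops_at (chase (barbell n c) x) r t = [x - int t] \<and> 0 \<le> x - int t \<and> r t < x - int t)"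
  using free
proof (induction t)
  case 0
  then have "r 0 \<noteq> x" by (auto simp: captured_in_round_def cops_at_def chase_def)
  then show ?case using x by (auto simp: cops_at_def chase_def)
next
  case (Suc t)
  let ?G = "barbell n c"
  define u where "u = foldl (chase_step ?G) x (map r [0..<t])"
  have u: "cops_at (chase ?G x) r t = [u]" by (simp add: u_def cops_at_def chase_def)
  have w: "cops_at (chase ?G x) r (Suc t) = [chase_step ?G u (r t)]"
    by (simp add: u_def cops_at_def chase_def)
  have free: "r t \<noteq> chase_step ?G u (r t)" "r (Suc t) \<noteq> chase_step ?G u (r t)"
    using Suc.prems[of "Suc t"] unfolding captured_in_round_def w by auto
  then have far: "r t \<notin> nbrs ?G u" by (auto simp: chase_step_def)
  have v: "r t \<in> verts ?G" using robber_play_verts assms by simp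
  have mv: "r (Suc t) = r t \<or> r (Suc t) \<in> nbrs ?G (r t)"
    using assms(3) by (simp add: robber_plays_def)
  have IH: "u = x + int t \<and> x + int t \<le> int n - 1 \<and> x + int t < r t \<or>
      u = x - int t \<and> 0 \<le> x - int t \<and> r t < x - int t"
    using Suc by (simp add: u)
  then show ?case
  proof (elim disjE conjE)
    assume h: "u = x + int t" "x + int t \<le> int n - 1" "x + int t < r t"
    \<comment> \<open>At the end of the path all vertices ahead belong to the cop's own clique, so
      the robber would be adjacent and captured by the next move.\<close>
    have "u \<noteq> int n - 1"
    proof
      assume "u = int n - 1"
      then have "r t \<in> nbrs ?G u" using h v assms(1) by (simp add: mem_nbrs_barbell verts_barbell)
      then show False using far by simp
    qed
    then have u1: "u + 1 \<in> nbrs ?G u" "u \<le> int n - 2" using h x assms(1)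
      by (simp_all add: mem_nbrs_barbell)
    then have st: "chase_step ?G u (r t) = u + 1" using far h by (simp add: chase_step_def)
    have "u + 1 < r t" using free(1) st h by simp
    \<comment> \<open>To get past the cop the robber would first have to step onto
      \<open>u + 1\<close>, where the cop now stands; \<open>free(2)\<close> excludes this.\<close>
    moreover have "r (Suc t) \<ge> u + 1"
      using mv \<open>u + 1 < r t\<close> u1(2) x h(1) assms(1) by (auto simp: mem_nbrs_barbell)
    ultimately have "u + 1 < r (Suc t)" using free(2) st by simp
    then show ?thesis using u1 h w st by simp
  next
    assume h: "u = x - int t" "0 \<le> x - int t" "r t < x - int t"
    have "u \<noteq> 0"
    proof
      assume "u = 0"
      then have "r t \<in> nbrs ?G u" using h v assms(1) by (simp add: mem_nbrs_barbell verts_barbell)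
      then show False using far by simp
    qed
    then have u1: "u - 1 \<in> nbrs ?G u" "1 \<le> u" using h x assms(1)
      by (simp_all add: mem_nbrs_barbell)
    then have st: "chase_step ?G u (r t) = u - 1" using far h by (simp add: chase_step_def)
    have "u - 1 > r t" using free(1) st h by simp
    moreover have "r (Suc t) \<le> u - 1"
      using mv \<open>u - 1 > r t\<close> u1(2) x h(1) assms(1) by (auto simp: mem_nbrs_barbell)
    ultimately have "u - 1 > r (Suc t)" using free(2) st by simp
    then show ?thesis using u1 h w st by simp
  qed
qed

text \<open>Otherwise \<open>chase_invariant\<close> would put the cop at 2 (n div 2) + 1 >= n or at
  -1, both off the path.\<close>

lemma chase_capture:
  assumes "n \<ge> 2" "y \<in> verts (barbell n c)" "r \<in> robber_plays (barbell n c) y"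
  shows "\<exists>s\<le>n div 2 + 1. captured_in_round (chase (barbell n c) (int (n div 2))) r s"
proof (rule ccontr)
  assume "\<not> ?thesis"
  then have "\<And>s. s \<le> n div 2 + 1 \<Longrightarrow> \<not> captured_in_round (chase (barbell n c) (int (n div 2))) r s"
    by blast
  from chase_invariant[where t = "n div 2 + 1", OF assms _ _ this] \<open>n \<ge> 2\<close> show False by auto
qed

lemma chase_capture_displacement:
  assumes "n \<ge> 2" "y \<in> verts (barbell n c)" "r \<in> robber_plays (barbell n c) y" "L \<ge> 0"
    and small: "\<And>s. s \<le> n \<Longrightarrow> real_of_int \<bar>clamp n (r s) - clamp n y\<bar> < L"
  shows "capture_time (chase (barbell n c) (int (n div 2))) r
     \<le> enat (nat \<lfloor>real_of_int \<bar>int (n div 2) - clamp n y\<bar> + L\<rfloor> + 1)"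
proof -
  define \<sigma> where "\<sigma> = chase (barbell n c) (int (n div 2))"
  define t where "t = nat \<lfloor>real_of_int \<bar>int (n div 2) - clamp n y\<bar> + L\<rfloor> + 1"
  have t: "real t > real_of_int \<bar>int (n div 2) - clamp n y\<bar> + L"
    unfolding t_def using \<open>L \<ge> 0\<close> by linarith
  have "\<exists>s\<le>t. captured_in_round \<sigma> r s"
  proof (cases "t \<le> n")
    case True
    show ?thesis
    proof (rule ccontr)
      assume "\<not> ?thesis"
      then have "\<And>s. s \<le> t \<Longrightarrow> \<not> captured_in_round (chase (barbell n c) (int (n div 2))) r s"
        unfolding \<sigma>_def by blast
      \<comment> \<open>The robber is beyond the cop, who is t steps from the middle; so the robber
        has been driven that far, more than \<open>small\<close> permits.\<close>
      from chase_invariant[where t = t, OF assms(1-3) _ _ this] \<open>n \<ge> 2\<close>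
      have "\<bar>clamp n (r t) - int (n div 2)\<bar> \<ge> int t" by (auto simp: clamp_def)
      with small[OF True] t show False by linarith
    qed
  next
    \<comment> \<open>Here \<open>small\<close> says nothing about time t, but the chase is already
      over: n div 2 + 1 <= n < t.\<close>
    case False
    obtain s where "s \<le> n div 2 + 1" "captured_in_round \<sigma> r s"
      using chase_capture[OF assms(1-3)] unfolding \<sigma>_def by blast
    moreover from this have "s \<le> t" using False \<open>n \<ge> 2\<close> by linarith
    ultimately show ?thesis by blast
  qed
  then show ?thesis unfolding \<sigma>_def t_def using capture_time_le by blast
qed


section \<open>One cop suffices\<close>

lemma cop_positions_0: "cop_positions G 0 = {[]}"
  by (auto simp: cop_positions_def)

lemma cop_positions_1: "cop_positions G 1 = (\<lambda>v. [v]) ` verts G"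
  by (auto simp: cop_positions_def length_Suc_conv)

lemma midpoint_in_verts: "n \<ge> 2 \<Longrightarrow> int (n div 2) \<in> verts (barbell n c)"
  using clique_excess_nonneg[of n c] by (simp add: verts_barbell)

lemma cop_number_barbell:
  assumes "n \<ge> 2"
  shows "cop_number (barbell n c) = 1"
proof -
  let ?G = "barbell n c"
  have "\<not> cops_can_win ?G 0"
  proof
    assume "cops_can_win ?G 0"
    then obtain \<sigma> where \<sigma>: "\<sigma> \<in> cop_strategies ?G []"
      and win: "\<forall>y \<in> verts ?G. \<forall>r \<in> robber_plays ?G y. \<exists>t. captured_in_round \<sigma> r t"
      by (auto simp: cops_can_win_def cop_positions_0)
    have empty: "\<sigma> h = []" for h
    proof (induction h rule: rev_induct)
      case (snoc r h)
      have "cop_move ?G (\<sigma> h) (\<sigma> (h @ [r]))" using \<sigma> by (simp add: cop_strategies_def)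
      then show ?case by (simp add: snoc cop_move_def)
    qed (use \<sigma> in \<open>simp add: cop_strategies_def\<close>)
    have "(\<lambda>_. int (n div 2)) \<in> robber_plays ?G (int (n div 2))" by (simp add: robber_plays_def)
    with win midpoint_in_verts[OF assms] have "\<exists>t. captured_in_round \<sigma> (\<lambda>_. int (n div 2)) t" by blast
    then show False by (simp add: captured_in_round_def cops_at_def empty)
  qed
  moreover have "cops_can_win ?G 1"
    unfolding cops_can_win_def cop_positions_1
    using midpoint_in_verts[OF assms] chase_in_cop_strategies chase_capture[OF assms] by blast
  ultimately show ?thesis unfolding cop_number_def
    by (metis LeastI One_nat_def Least_le le_Suc_eq le_zero_eq)
qed

text \<open>The value is pinned down within 1 of n / 2, enough for the limit of ct / n. The robber
  of the lower bound waits at an end of the path.\<close>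

lemma ct_barbell:
  assumes "n \<ge> 2"
  obtains k where "ct (barbell n c) = enat k" "n \<le> 2 * k + 2" "2 * k \<le> n + 2"
proof -
  let ?G = "barbell n c"
  have ct: "ct ?G = (INF x \<in> verts ?G. SUP y \<in> verts ?G. ct_from ?G [x] y)"
    by (simp add: ct_def cop_number_barbell[OF assms] ct_k_def cop_positions_1[unfolded One_nat_def] image_image)
  have "ct_from ?G [int (n div 2)] y \<le> enat (n div 2 + 1)" if y: "y \<in> verts ?G" for y
    unfolding ct_from_def
  proof (rule INF_lower2[OF chase_in_cop_strategies], rule SUP_least)
    fix r assume "r \<in> robber_plays ?G y"
    then show "capture_time (chase ?G (int (n div 2))) r \<le> enat (n div 2 + 1)"
      using chase_capture[OF assms y] capture_time_le by blast
  qed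
  then have upper: "ct ?G \<le> enat (n div 2 + 1)"
    unfolding ct using midpoint_in_verts[OF assms] by (intro INF_lower2[of "int (n div 2)"] SUP_least)
  have lower: "enat ((n - 1) div 2) \<le> ct ?G"
    unfolding ct
  proof (rule INF_greatest)
    fix x assume "x \<in> verts ?G"
    \<comment> \<open>The end of the path farther from the cop, at distance at least (n - 1) /
      2.\<close>
    define y where "y = (if 2 * clamp n x \<le> int n - 1 then int n - 1 else 0)"
    have y: "y \<in> verts ?G" "clamp n y = y"
      using assms clique_excess_nonneg[of n c] by (auto simp: y_def verts_barbell clamp_def)
    have dist: "int n - 1 \<le> 2 * \<bar>clamp n x - clamp n y\<bar>"
      unfolding y(2) unfolding y_def by auto
    have "enat ((n - 1) div 2) \<le> ct_from ?G [x] y"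
      unfolding ct_from_def
    proof (rule INF_greatest)
      fix \<sigma> assume \<sigma>: "\<sigma> \<in> cop_strategies ?G [x]"
      have "enat ((n - 1) div 2) \<le> capture_time \<sigma> (\<lambda>_. y)"
      proof (rule capture_time_ge, rule notI)
        fix t assume t: "t < (n - 1) div 2" "captured_in_round \<sigma> (\<lambda>_. y) t"
        then have "2 * \<bar>clamp n x - clamp n y\<bar> \<le> 2 * int t"
          using captured_imp_dist[OF _ \<sigma>] assms by auto
        with dist have "int n - 1 \<le> 2 * int t" by (rule order_trans)
        with t(1) assms show False by presburger
      qed
      also have "\<dots> \<le> (SUP r \<in> robber_plays ?G y. capture_time \<sigma> r)"
        by (rule SUP_upper) (simp add: robber_plays_def)
      finally show "enat ((n - 1) div 2) \<le> (SUP r \<in> robber_plays ?G y. capture_time \<sigma> r)" .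
    qed
    also have "\<dots> \<le> (SUP y \<in> verts ?G. ct_from ?G [x] y)" using y(1) by (rule SUP_upper)
    finally show "enat ((n - 1) div 2) \<le> (SUP y \<in> verts ?G. ct_from ?G [x] y)" .
  qed
  from upper obtain k where k: "ct ?G = enat k" by (metis enat_ile)
  show ?thesis
    by (rule that[OF k]) (use upper lower k in auto)
qed


section \<open>Expected capture times\<close>

text \<open>The displacement threshold \<open>n powr (2/3)\<close> balances the two error terms: within \<open>n\<close> rounds it
  is exceeded with probability at most \<open>n powr (- 1/3)\<close>, at a cost of at most \<open>n\<close> rounds.\<close>

definition drunk_error :: "nat \<Rightarrow> real" where
  "drunk_error n = 2 * real n powr (2/3) + 1"

text \<open>Watching n rounds is enough: collapsed distances are below n, and the chase from the
  middle ends within n rounds.\<close>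

definition far_event :: "nat \<Rightarrow> int \<Rightarrow> (int \<Rightarrow> int) stream set" where
  "far_event n y = {\<omega>. \<exists>s\<le>n. real_of_int \<bar>clamp n (drunk_walk y \<omega> s) - clamp n y\<bar> \<ge> real n powr (2/3)}"

lemma sets_far_event: "far_event n y \<in> sets (drunk_choices G)"
  unfolding far_event_def by (rule sets_exists_drunk_walk)

lemma not_far_event:
  assumes "\<omega> \<notin> far_event n y" "s \<le> n"
  shows "real_of_int \<bar>clamp n (drunk_walk y \<omega> s) - clamp n y\<bar> < real n powr (2/3)"
  using assms unfolding far_event_def mem_Collect_eq by (meson not_le)

text \<open>With \<open>a = clamp n y\<close> the initial term of \<open>displacement_bound\<close>
  vanishes and n / L^2 remains, where L = n^(2/3); n times this is L again.\<close>

lemma far_event_bound: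
  assumes "n \<ge> 2" "y \<in> verts (barbell n c)"
  shows "of_nat n * emeasure (drunk_choices (barbell n c)) (far_event n y) \<le> ennreal (real n powr (2/3))"
proof -
  have "emeasure (drunk_choices (barbell n c)) (far_event n y) \<le> ennreal (real n / (real n powr (2/3))\<^sup>2)"
    using displacement_bound[OF assms, of "clamp n y" "real n powr (2/3)" n] clamp_bounds[of n y] assms(1)
    by (simp add: far_event_def)
  then have "of_nat n * emeasure (drunk_choices (barbell n c)) (far_event n y)
      \<le> ennreal (real n) * ennreal (real n / (real n powr (2/3))\<^sup>2)"
    by (simp add: ennreal_of_nat_eq_real_of_nat mult_left_mono)
  also have "\<dots> = ennreal (real n * (real n / (real n powr (2/3))\<^sup>2))"
    by (rule ennreal_mult'[symmetric]) simp
  also have "real n * (real n / (real n powr (2/3))\<^sup>2) = real n powr (2/3)"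
  proof -
    have "(real n powr (2/3))\<^sup>2 = real n powr (4/3)"
      by (simp add: power2_eq_square flip: powr_add)
    moreover have "real n * (real n / real n powr (4/3)) = real n powr 1 * (real n powr 1 / real n powr (4/3))"
      using assms(1) by simp
    moreover have "\<dots> = real n powr (2/3)"
      by (simp only: powr_diff[symmetric] powr_add[symmetric]) simp
    ultimately show ?thesis by (simp only:)
  qed
  finally show ?thesis .
qed

lemma dct_from_lower:
  assumes n: "n \<ge> 2" and y: "y \<in> verts (barbell n c)"
  shows "ennreal (real_of_int \<bar>clamp n x - clamp n y\<bar> - drunk_error n) \<le> dct_from (barbell n c) [x] y"
  unfolding dct_from_def
proof (rule INF_greatest)
  let ?M = "drunk_choices (barbell n c)"
  define d L where "d = real_of_int \<bar>clamp n x - clamp n y\<bar>" and "L = real n powr (2/3)"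
  fix \<sigma> assume \<sigma>: "\<sigma> \<in> cop_strategies (barbell n c) [x]"
  let ?T = "\<lambda>\<omega>. ennreal_of_enat (capture_time \<sigma> (drunk_walk y \<omega>))"
  have "d \<le> real n"
    using clamp_bounds[of n x] clamp_bounds[of n y] n unfolding d_def by linarith
  \<comment> \<open>The exceptional term is added on the right because capture times may be infinite
    and subtraction in \<open>ennreal\<close> truncates; L is subtracted only after
    integrating.\<close>
  have pw: "ennreal (d - L) \<le> ?T \<omega> + of_nat n * indicator (far_event n y) \<omega>" for \<omega>
  proof (cases "\<omega> \<in> far_event n y")
    case True
    have "ennreal (d - L) \<le> ennreal (real n)"
      using \<open>d \<le> real n\<close> by (intro ennreal_leI) (simp add: L_def order_trans[of _ d])
    then show ?thesis using True
      by (simp add: ennreal_of_nat_eq_real_of_nat add_increasing)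
  next
    case False
    then have "enat (nat \<lceil>d - L\<rceil>) \<le> capture_time \<sigma> (drunk_walk y \<omega>)"
      unfolding d_def L_def
      using n not_far_event by (intro capture_time_lower[OF _ \<sigma>]) auto
    then have T: "ennreal_of_enat (enat (nat \<lceil>d - L\<rceil>)) \<le> ?T \<omega>"
      by (simp only: ennreal_of_enat_le_iff)
    have "ennreal (d - L) \<le> ennreal (real (nat \<lceil>d - L\<rceil>))"
      by (intro ennreal_leI) linarith
    also have "\<dots> = ennreal_of_enat (enat (nat \<lceil>d - L\<rceil>))"
      by (simp only: ennreal_of_enat_enat ennreal_of_nat_eq_real_of_nat)
    also note T
    finally show ?thesis using False by simp
  qed
  have [measurable]: "?T \<in> borel_measurable ?M" by (rule measurable_capture_time)
  have [measurable]: "far_event n y \<in> sets ?M" by (rule sets_far_event)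
  have "ennreal (d - L) = (\<integral>\<^sup>+ \<omega>. ennreal (d - L) \<partial>?M)"
    using prob_space.emeasure_space_1[OF prob_space_drunk_choices[of "barbell n c"]] by simp
  also have "\<dots> \<le> (\<integral>\<^sup>+ \<omega>. ?T \<omega> + of_nat n * indicator (far_event n y) \<omega> \<partial>?M)"
    by (intro nn_integral_mono pw)
  also have "\<dots> = (\<integral>\<^sup>+ \<omega>. ?T \<omega> \<partial>?M) + of_nat n * emeasure ?M (far_event n y)"
    by (simp add: nn_integral_add nn_integral_cmult)
  also have "\<dots> \<le> (\<integral>\<^sup>+ \<omega>. ?T \<omega> \<partial>?M) + ennreal L"
    unfolding L_def by (intro add_left_mono far_event_bound[OF n y])
  finally have "ennreal (d - L) - ennreal L \<le> (\<integral>\<^sup>+ \<omega>. ?T \<omega> \<partial>?M)"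
    by (simp add: ennreal_minus_le_iff add.commute)
  moreover have "ennreal (d - L) - ennreal L = ennreal (d - L - L)"
    by (simp add: ennreal_minus L_def)
  ultimately have "ennreal (d - L - L) \<le> (\<integral>\<^sup>+ \<omega>. ?T \<omega> \<partial>?M)" by simp
  moreover have "ennreal (d - drunk_error n) \<le> ennreal (d - L - L)"
    by (intro ennreal_leI) (simp add: drunk_error_def L_def)
  ultimately show "ennreal (real_of_int \<bar>clamp n x - clamp n y\<bar> - drunk_error n) \<le> (\<integral>\<^sup>+ \<omega>. ?T \<omega> \<partial>?M)"
    unfolding d_def[symmetric] by (rule order_trans[rotated])
qed

text \<open>The pathwise bound holds only almost everywhere, since the chase is guaranteed to
  succeed only against legal plays.\<close>

lemma dct_from_upper:
  assumes n: "n \<ge> 2" and y: "y \<in> verts (barbell n c)"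
  shows "dct_from (barbell n c) [int (n div 2)] y
     \<le> ennreal (real_of_int \<bar>int (n div 2) - clamp n y\<bar> + drunk_error n)"
proof -
  let ?M = "drunk_choices (barbell n c)"
  define d L where "d = real_of_int \<bar>int (n div 2) - clamp n y\<bar>" and "L = real n powr (2/3)"
  define \<sigma> where "\<sigma> = chase (barbell n c) (int (n div 2))"
  let ?T = "\<lambda>\<omega>. ennreal_of_enat (capture_time \<sigma> (drunk_walk y \<omega>))"
  have nonneg: "d \<ge> 0" "L \<ge> 0" by (simp_all add: d_def L_def)
  have "AE \<omega> in ?M. drunk_walk y \<omega> \<in> robber_plays (barbell n c) y"
    using n y by (intro AE_drunk_walk_plays finite_verts_barbell nbrs_barbell_nonempty conjI
        nbrs_barbell_subset) auto
  then have pw: "AE \<omega> in ?M. ?T \<omega> \<le> ennreal (d + L + 1) + of_nat n * indicator (far_event n y) \<omega>"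
  proof eventually_elim
    case (elim \<omega>)
    show ?case
    proof (cases "\<omega> \<in> far_event n y")
      case True
      obtain s where s: "s \<le> n div 2 + 1" "captured_in_round \<sigma> (drunk_walk y \<omega>) s"
        using chase_capture[OF n y elim] unfolding \<sigma>_def by blast
      have "capture_time \<sigma> (drunk_walk y \<omega>) \<le> enat n"
        using capture_time_le[OF s(2), of n] s(1) n by linarith
      then have "?T \<omega> \<le> ennreal_of_enat (enat n)" by (simp only: ennreal_of_enat_le_iff)
      then show ?thesis using True by (simp add: add_increasing)
    next
      case False
      have "capture_time \<sigma> (drunk_walk y \<omega>) \<le> enat (nat \<lfloor>d + L\<rfloor> + 1)"
        unfolding \<sigma>_def d_def L_def
        using False not_far_event by (intro chase_capture_displacement[OF n y elim]) auto
      then have "?T \<omega> \<le> ennreal_of_enat (enat (nat \<lfloor>d + L\<rfloor> + 1))" by (simp only: ennreal_of_enat_le_iff)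
      also have "\<dots> = ennreal (real (nat \<lfloor>d + L\<rfloor> + 1))"
        by (simp only: ennreal_of_enat_enat ennreal_of_nat_eq_real_of_nat)
      also have "\<dots> \<le> ennreal (d + L + 1)"
        using nonneg by (intro ennreal_leI) linarith
      finally show ?thesis using False by simp
    qed
  qed
  have [measurable]: "far_event n y \<in> sets ?M" by (rule sets_far_event)
  have "dct_from (barbell n c) [int (n div 2)] y \<le> (\<integral>\<^sup>+ \<omega>. ?T \<omega> \<partial>?M)"
    unfolding dct_from_def \<sigma>_def by (rule INF_lower) (rule chase_in_cop_strategies)
  also have "\<dots> \<le> (\<integral>\<^sup>+ \<omega>. ennreal (d + L + 1) + of_nat n * indicator (far_event n y) \<omega> \<partial>?M)"
    by (rule nn_integral_mono_AE[OF pw])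
  also have "\<dots> = ennreal (d + L + 1) + of_nat n * emeasure ?M (far_event n y)"
    using prob_space.emeasure_space_1[OF prob_space_drunk_choices[of "barbell n c"]]
    by (simp add: nn_integral_add nn_integral_cmult)
  also have "\<dots> \<le> ennreal (d + L + 1) + ennreal L"
    unfolding L_def by (intro add_left_mono far_event_bound[OF n y])
  \<comment> \<open>One L is the displacement, the other the exceptional event, and 1 the rounding
    to whole rounds: this is \<open>drunk_error\<close>.\<close>
  also have "\<dots> = ennreal (d + drunk_error n)"
    using nonneg by (simp add: drunk_error_def L_def flip: ennreal_plus)
  finally show ?thesis unfolding d_def .
qed


section \<open>Averaging over the initial vertex\<close>

text \<open>The mean collapsed distance to the centre (n - 1) / 2 of the path. The centre need not
  be a vertex, so distances are doubled to stay in the integers and halved afterwards.\<close>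

definition mean_dist :: "nat \<Rightarrow> real \<Rightarrow> real" where
  "mean_dist n c = (\<Sum>y\<in>verts (barbell n c). real_of_int \<bar>int n - 1 - 2 * clamp n y\<bar>) / 2
     / real (card (verts (barbell n c)))"

text \<open>Pairing each vertex with its mirror image shows that the middle of the path minimizes the mean
  distance.\<close>

lemma sum_dist_reflect:
  assumes "n \<ge> 1"
  shows "2 * (\<Sum>y\<in>verts (barbell n c). \<bar>a - clamp n y\<bar>) =
     (\<Sum>y\<in>verts (barbell n c). \<bar>a - clamp n y\<bar> + \<bar>a - (int n - 1 - clamp n y)\<bar>)"
proof -
  have "(\<Sum>y\<in>verts (barbell n c). \<bar>a - clamp n y\<bar>) =
      (\<Sum>y\<in>verts (barbell n c). \<bar>a - (int n - 1 - clamp n y)\<bar>)"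
    using assms by (intro sum.reindex_bij_witness[of _ "\<lambda>v. int n - 1 - v" "\<lambda>v. int n - 1 - v"])
      (auto simp: verts_barbell clamp_def)
  then show ?thesis by (simp add: sum.distrib)
qed

text \<open>Termwise triangle inequality: a point and its mirror image are
  \<open>\<bar>int n - 1 - 2 * clamp n y\<bar>\<close> apart.\<close>

lemma sum_dist_lower:
  assumes "n \<ge> 1"
  shows "(\<Sum>y\<in>verts (barbell n c). \<bar>int n - 1 - 2 * clamp n y\<bar>)
     \<le> 2 * (\<Sum>y\<in>verts (barbell n c). \<bar>a - clamp n y\<bar>)"
  unfolding sum_dist_reflect[OF assms] by (intro sum_mono) linarith

text \<open>The cop must start on a vertex, and \<open>n div 2\<close> is off the centre by at most
  1/2; so each mirror pair costs at most 1 more.\<close>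

lemma sum_dist_upper:
  assumes "n \<ge> 1"
  shows "2 * (\<Sum>y\<in>verts (barbell n c). \<bar>int (n div 2) - clamp n y\<bar>)
     \<le> (\<Sum>y\<in>verts (barbell n c). \<bar>int n - 1 - 2 * clamp n y\<bar>) + int (card (verts (barbell n c)))"
proof -
  have "(\<Sum>y\<in>verts (barbell n c). \<bar>int (n div 2) - clamp n y\<bar> + \<bar>int (n div 2) - (int n - 1 - clamp n y)\<bar>)
      \<le> (\<Sum>y\<in>verts (barbell n c). \<bar>int n - 1 - 2 * clamp n y\<bar> + 1)"
  proof (rule sum_mono)
    fix y
    have "2 * int (n div 2) = int n \<or> 2 * int (n div 2) = int n - 1" by presburger
    then show "\<bar>int (n div 2) - clamp n y\<bar> + \<bar>int (n div 2) - (int n - 1 - clamp n y)\<bar>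
        \<le> \<bar>int n - 1 - 2 * clamp n y\<bar> + 1" by linarith
  qed
  then show ?thesis unfolding sum_dist_reflect[OF assms] by (simp add: sum.distrib)
qed

text \<open>Distances minus \<open>drunk_error\<close> may be negative, and \<open>ennreal\<close>
  sends negative terms to 0, so equality can fail.\<close>

lemma ennreal_sum_le: "ennreal (\<Sum>y\<in>A. f y) \<le> (\<Sum>y\<in>A. ennreal (f y))"
proof -
  have "ennreal (\<Sum>y\<in>A. f y) \<le> ennreal (\<Sum>y\<in>A. max 0 (f y))"
    by (intro ennreal_leI sum_mono) simp
  also have "\<dots> = (\<Sum>y\<in>A. ennreal (f y))" by (subst sum_ennreal[symmetric]) simp_all
  finally show ?thesis .
qed

lemma card_verts_barbell_eq:
  "n \<ge> 1 \<Longrightarrow> real (card (verts (barbell n c))) = real n + 2 * real_of_int (clique_excess n c)"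
  using clique_excess_nonneg[of n c] by (simp add: verts_barbell)

lemma dct_barbell_eq:
  assumes "n \<ge> 2"
  shows "dct (barbell n c) =
    (INF x\<in>verts (barbell n c). (\<Sum>y \<in> verts (barbell n c). dct_from (barbell n c) [x] y)
       / of_nat (card (verts (barbell n c))))"
  unfolding dct_def cop_number_barbell[OF assms] dct_k_def cop_positions_1 image_image ..

lemma dct_barbell_lower:
  assumes n: "n \<ge> 2"
  shows "ennreal (mean_dist n c - drunk_error n) \<le> dct (barbell n c)"
  unfolding dct_barbell_eq[OF n]
proof (rule INF_greatest)
  fix x
  let ?V = "verts (barbell n c)" and ?S = "\<Sum>y\<in>verts (barbell n c). real_of_int \<bar>clamp n x - clamp n y\<bar> - drunk_error n"
  have card: "real (card ?V) > 0"
    using card_verts_barbell_eq[of n c] clique_excess_nonneg[of n c] n by simp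
  have "mean_dist n c - drunk_error n =
      ((\<Sum>y\<in>?V. real_of_int \<bar>int n - 1 - 2 * clamp n y\<bar>) / 2 - drunk_error n * real (card ?V)) / real (card ?V)"
    using card by (simp add: mean_dist_def diff_divide_distrib)
  also have "\<dots> \<le> ?S / real (card ?V)"
  proof (rule divide_right_mono)
    have "real_of_int (\<Sum>y\<in>?V. \<bar>int n - 1 - 2 * clamp n y\<bar>)
        \<le> real_of_int (2 * (\<Sum>y\<in>?V. \<bar>clamp n x - clamp n y\<bar>))"
      using sum_dist_lower[of n c "clamp n x"] n by (simp only: of_int_le_iff)
    then show "(\<Sum>y\<in>?V. real_of_int \<bar>int n - 1 - 2 * clamp n y\<bar>) / 2 - drunk_error n * real (card ?V)
        \<le> ?S"
      by (simp add: sum_subtractf)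
  qed simp
  finally have "ennreal (mean_dist n c - drunk_error n) \<le>
      ennreal (?S / real (card ?V))"
    by (rule ennreal_leI)
  also have "ennreal (?S / real (card ?V)) = ennreal ?S / of_nat (card ?V)"
  \<comment> \<open>The error may exceed the mean distance; then both sides are truncated to
    0.\<close>
  proof (cases "?S \<ge> 0")
    case True
    then show ?thesis
      using divide_ennreal[OF True card] by (simp only: ennreal_of_nat_eq_real_of_nat)
  next
    case False
    then have "ennreal ?S = 0" "ennreal (?S / real (card ?V)) = 0"
      by (intro ennreal_neg divide_nonpos_nonneg; linarith)+
    then show ?thesis by (simp only: ennreal_zero_divide)
  qed
  also have "\<dots> \<le> (\<Sum>y\<in>?V. dct_from (barbell n c) [x] y) / of_nat (card ?V)"
    by (intro divide_right_mono_ennreal order_trans[OF ennreal_sum_le] sum_mono dct_from_lower[OF n])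
  finally show "ennreal (mean_dist n c - drunk_error n) \<le>
      (\<Sum>y\<in>?V. dct_from (barbell n c) [x] y) / of_nat (card ?V)" .
qed

lemma dct_barbell_upper:
  assumes n: "n \<ge> 2"
  shows "dct (barbell n c) \<le> ennreal (mean_dist n c + 1 + drunk_error n)"
proof -
  let ?V = "verts (barbell n c)"
  have card: "real (card ?V) > 0"
    using card_verts_barbell_eq[of n c] clique_excess_nonneg[of n c] n by simp
  have "dct (barbell n c) \<le> (\<Sum>y\<in>?V. dct_from (barbell n c) [int (n div 2)] y) / of_nat (card ?V)"
    unfolding dct_barbell_eq[OF n] by (rule INF_lower) (rule midpoint_in_verts[OF n])
  also have "\<dots> \<le> (\<Sum>y\<in>?V. ennreal (real_of_int \<bar>int (n div 2) - clamp n y\<bar> + drunk_error n)) / of_nat (card ?V)"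
    by (intro divide_right_mono_ennreal sum_mono dct_from_upper[OF n])
  also have "\<dots> = ennreal ((\<Sum>y\<in>?V. real_of_int \<bar>int (n div 2) - clamp n y\<bar> + drunk_error n) / real (card ?V))"
    using card by (subst sum_ennreal)
      (auto simp: ennreal_of_nat_eq_real_of_nat drunk_error_def intro!: divide_ennreal sum_nonneg)
  also have "\<dots> \<le> ennreal (mean_dist n c + 1 + drunk_error n)"
  proof (rule ennreal_leI)
    have "real_of_int (2 * (\<Sum>y\<in>?V. \<bar>int (n div 2) - clamp n y\<bar>))
        \<le> real_of_int ((\<Sum>y\<in>?V. \<bar>int n - 1 - 2 * clamp n y\<bar>) + int (card ?V))"
      using sum_dist_upper[of n c] n by (simp only: of_int_le_iff)
    \<comment> \<open>Halving leaves an excess of 1/2 per vertex, rounded up to 1.\<close>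
    then have "(\<Sum>y\<in>?V. real_of_int \<bar>int (n div 2) - clamp n y\<bar> + drunk_error n)
        \<le> (\<Sum>y\<in>?V. real_of_int \<bar>int n - 1 - 2 * clamp n y\<bar>) / 2 + (1 + drunk_error n) * real (card ?V)"
      using card by (simp add: sum.distrib algebra_simps)
    then have "(\<Sum>y\<in>?V. real_of_int \<bar>int (n div 2) - clamp n y\<bar> + drunk_error n) / real (card ?V)
        \<le> ((\<Sum>y\<in>?V. real_of_int \<bar>int n - 1 - 2 * clamp n y\<bar>) / 2 + (1 + drunk_error n) * real (card ?V))
          / real (card ?V)"
      by (rule divide_right_mono) simp
    also have "\<dots> = mean_dist n c + 1 + drunk_error n"
      using card by (simp add: mean_dist_def add_divide_distrib)
    finally show "(\<Sum>y\<in>?V. real_of_int \<bar>int (n div 2) - clamp n y\<bar> + drunk_error n) / real (card ?V)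
        \<le> mean_dist n c + 1 + drunk_error n" .
  qed
  finally show ?thesis .
qed


section \<open>Asymptotics\<close>

text \<open>Twice the sum is n^2 for even n and n^2 - 1 for odd n; the two bounds avoid the case
  split. From n to n + 2 the old terms reappear, shifted, between two new outer terms n + 1, whence
  the induction in steps of two.\<close>

lemma sum_centred_abs:
  "int n ^ 2 - 1 \<le> 2 * (\<Sum>j<n. \<bar>int n - 1 - 2 * int j\<bar>) \<and>
   2 * (\<Sum>j<n. \<bar>int n - 1 - 2 * int j\<bar>) \<le> int n ^ 2"
proof (induction n rule: induct_nat_012)
  case (ge2 n)
  have "(\<Sum>j<Suc (Suc n). \<bar>int (Suc (Suc n)) - 1 - 2 * int j\<bar>) =
      int n + 1 + (\<Sum>j<Suc n. \<bar>int n - 1 - 2 * int j\<bar>)"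
    by (subst sum.lessThan_Suc_shift) (simp add: algebra_simps)
  also have "\<dots> = (\<Sum>j<n. \<bar>int n - 1 - 2 * int j\<bar>) + 2 * int n + 2"
    by simp
  finally show ?case using ge2 by (simp add: power2_eq_square algebra_simps)
qed simp_all

text \<open>Off-path vertices collapse to an end, where the doubled distance to the centre is n -
  1.\<close>

lemma sum_verts_barbell:
  assumes "n \<ge> 1"
  shows "(\<Sum>y\<in>verts (barbell n c). \<bar>int n - 1 - 2 * clamp n y\<bar>) =
     (\<Sum>j<n. \<bar>int n - 1 - 2 * int j\<bar>) + 2 * clique_excess n c * (int n - 1)"
proof -
  let ?a = "clique_excess n c" and ?f = "\<lambda>y. \<bar>int n - 1 - 2 * clamp n y\<bar>"
  have split: "verts (barbell n c) = {- ?a..-1} \<union> {0..int n - 1} \<union> {int n..int n - 1 + ?a}"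
    using assms clique_excess_nonneg[of n c] by (auto simp: verts_barbell)
  have "sum ?f (verts (barbell n c)) =
      sum ?f {- ?a..-1} + sum ?f {0..int n - 1} + sum ?f {int n..int n - 1 + ?a}"
    unfolding split by (subst sum.union_disjoint; auto)+
  also have "sum ?f {- ?a..-1} = (\<Sum>y\<in>{- ?a..-1}. int n - 1)"
    using assms by (intro sum.cong) (auto simp: clamp_def)
  also have "sum ?f {int n..int n - 1 + ?a} = (\<Sum>y\<in>{int n..int n - 1 + ?a}. int n - 1)"
    using assms by (intro sum.cong) (auto simp: clamp_def)
  also have "sum ?f {0..int n - 1} = (\<Sum>j<n. \<bar>int n - 1 - 2 * int j\<bar>)"
    by (intro sum.reindex_bij_witness[of _ int nat]) (auto simp: clamp_def)
  finally show ?thesis using clique_excess_nonneg[of n c] by simp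
qed

lemma mean_dist_bounds:
  fixes c :: real
  assumes "n \<ge> 1"
  defines "a \<equiv> real_of_int (clique_excess n c)"
  shows "((real n ^ 2 - 1) / 4 + a * (real n - 1)) / (real n + 2 * a) \<le> mean_dist n c"
    and "mean_dist n c \<le> (real n ^ 2 / 4 + a * (real n - 1)) / (real n + 2 * a)"
proof -
  define f where "f = (\<Sum>j<n. \<bar>int n - 1 - 2 * int j\<bar>)"
  have "real_of_int (\<Sum>y\<in>verts (barbell n c). \<bar>int n - 1 - 2 * clamp n y\<bar>) =
      real_of_int f + 2 * a * (real n - 1)"
    unfolding sum_verts_barbell[OF assms(1)] f_def[symmetric] a_def by simp
  then have eq: "mean_dist n c = (real_of_int f / 2 + a * (real n - 1)) / (real n + 2 * a)"
    unfolding mean_dist_def card_verts_barbell_eq[OF assms(1)] a_def by (simp add: add_divide_distrib)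
  have "real_of_int (int n ^ 2 - 1) \<le> real_of_int (2 * f)" "real_of_int (2 * f) \<le> real_of_int (int n ^ 2)"
    using sum_centred_abs[of n] unfolding f_def by (simp_all only: of_int_le_iff)
  then have f: "real n ^ 2 - 1 \<le> 2 * real_of_int f" "2 * real_of_int f \<le> real n ^ 2" by simp_all
  have "a \<ge> 0" using clique_excess_nonneg by (simp add: a_def)
  then show "((real n ^ 2 - 1) / 4 + a * (real n - 1)) / (real n + 2 * a) \<le> mean_dist n c"
    and "mean_dist n c \<le> (real n ^ 2 / 4 + a * (real n - 1)) / (real n + 2 * a)"
    unfolding eq using f by (auto intro!: divide_right_mono)
qed

lemma clique_excess_asymp:
  assumes "c \<ge> 0"
  shows "(\<lambda>n. real_of_int (clique_excess n c) / real n) \<longlonglongrightarrow> c"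
proof (rule tendsto_sandwich)
  \<comment> \<open>The floor and the clique vertex on the path each cost at most 1.\<close>
  show "\<forall>\<^sub>F n in sequentially. c - 2 / real n \<le> real_of_int (clique_excess n c) / real n"
    using eventually_gt_at_top[of 0]
  proof eventually_elim
    case (elim n)
    have "c * real n - 2 \<le> real_of_int (clique_excess n c)"
      unfolding clique_excess_def by linarith
    then have "(c * real n - 2) / real n \<le> real_of_int (clique_excess n c) / real n"
      by (rule divide_right_mono) simp
    then show ?case using elim by (simp add: diff_divide_distrib)
  qed
  show "\<forall>\<^sub>F n in sequentially. real_of_int (clique_excess n c) / real n \<le> c"
    using eventually_gt_at_top[of 0]
  proof eventually_elim
    case (elim n)
    have "0 \<le> c * real n" using assms by simp
    then have "real_of_int (clique_excess n c) \<le> c * real n"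
      unfolding clique_excess_def by linarith
    then show ?case using elim by (simp add: field_simps)
  qed
qed (real_asymp, simp)

lemma mean_dist_asymp:
  assumes "c \<ge> 0"
  shows "(\<lambda>n. mean_dist n c / real n) \<longlonglongrightarrow> (1 / 4 + c) / (1 + 2 * c)"
proof (rule tendsto_sandwich)
  let ?a = "\<lambda>n. real_of_int (clique_excess n c)"
  have pos: "1 + 2 * c \<noteq> 0" using assms by simp
  note a = clique_excess_asymp[OF assms]
  have inv: "(\<lambda>n. 1 / real n) \<longlonglongrightarrow> 0" by real_asymp
  \<comment> \<open>These are the bounds of \<open>mean_dist_bounds\<close> over n, rewritten in 1 /
    n and excess / n, whose limits are known.\<close>
  show "(\<lambda>n. (1 / 4 - (1 / real n) * (1 / real n) / 4 + ?a n / real n * (1 - 1 / real n)) / (1 + 2 * (?a n / real n)))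
      \<longlonglongrightarrow> (1 / 4 + c) / (1 + 2 * c)"
    by (rule tendsto_eq_intros a inv refl pos | simp)+
  show "(\<lambda>n. (1 / 4 + ?a n / real n * (1 - 1 / real n)) / (1 + 2 * (?a n / real n)))
      \<longlonglongrightarrow> (1 / 4 + c) / (1 + 2 * c)"
    by (rule tendsto_eq_intros a inv refl pos | simp)+
  show "\<forall>\<^sub>F n in sequentially.
      (1 / 4 - (1 / real n) * (1 / real n) / 4 + ?a n / real n * (1 - 1 / real n)) / (1 + 2 * (?a n / real n))
        \<le> mean_dist n c / real n"
    using eventually_gt_at_top[of 0]
  proof eventually_elim
    case (elim n)
    have "?a n \<ge> 0" using clique_excess_nonneg by simp
    have "(1 / 4 - (1 / real n) * (1 / real n) / 4 + ?a n / real n * (1 - 1 / real n)) / (1 + 2 * (?a n / real n))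
        = ((real n ^ 2 - 1) / 4 + ?a n * (real n - 1)) / (real n + 2 * ?a n) / real n"
    proof -
      have "1 / 4 - (1 / real n) * (1 / real n) / 4 + ?a n / real n * (1 - 1 / real n) =
          ((real n ^ 2 - 1) / 4 + ?a n * (real n - 1)) / (real n * real n)"
        using elim by (simp add: field_simps power2_eq_square)
      moreover have "1 + 2 * (?a n / real n) = (real n + 2 * ?a n) / real n"
        using elim by (simp add: field_simps)
      ultimately show ?thesis using elim by simp
    qed
    also have "\<dots> \<le> mean_dist n c / real n"
      using elim by (intro divide_right_mono mean_dist_bounds(1)) auto
    finally show ?case .
  qed
  show "\<forall>\<^sub>F n in sequentially. mean_dist n c / real n
      \<le> (1 / 4 + ?a n / real n * (1 - 1 / real n)) / (1 + 2 * (?a n / real n))"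
    using eventually_gt_at_top[of 0]
  proof eventually_elim
    case (elim n)
    have "mean_dist n c / real n \<le> (real n ^ 2 / 4 + ?a n * (real n - 1)) / (real n + 2 * ?a n) / real n"
      using elim by (intro divide_right_mono mean_dist_bounds(2)) auto
    also have "\<dots> = (1 / 4 + ?a n / real n * (1 - 1 / real n)) / (1 + 2 * (?a n / real n))"
    proof -
      have "1 / 4 + ?a n / real n * (1 - 1 / real n) =
          (real n ^ 2 / 4 + ?a n * (real n - 1)) / (real n * real n)"
        using elim by (simp add: field_simps power2_eq_square)
      moreover have "1 + 2 * (?a n / real n) = (real n + 2 * ?a n) / real n"
        using elim by (simp add: field_simps)
      ultimately show ?thesis using elim by simp
    qed
    finally show ?case .
  qed
qed

text \<open>Needed for passing to reals: \<open>enn2real\<close> sends infinity to 0 and is monotone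
  only below it.\<close>

lemma dct_barbell_finite: "n \<ge> 2 \<Longrightarrow> dct (barbell n c) < \<infinity>"
  using dct_barbell_upper[of n c] by (auto simp: less_top[symmetric] top_unique)

lemma dct_barbell_asymp:
  assumes "c \<ge> 0"
  shows "(\<lambda>n. enn2real (dct (barbell n c)) / real n) \<longlonglongrightarrow> (1 / 4 + c) / (1 + 2 * c)"
proof (rule tendsto_sandwich)
  have err: "(\<lambda>n. (1 + drunk_error n) / real n) \<longlonglongrightarrow> 0" "(\<lambda>n. drunk_error n / real n) \<longlonglongrightarrow> 0"
    unfolding drunk_error_def by real_asymp+
  show "(\<lambda>n. mean_dist n c / real n - drunk_error n / real n) \<longlonglongrightarrow> (1 / 4 + c) / (1 + 2 * c)"
    using tendsto_diff[OF mean_dist_asymp[OF assms] err(2)] by simp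
  show "(\<lambda>n. mean_dist n c / real n + (1 + drunk_error n) / real n) \<longlonglongrightarrow> (1 / 4 + c) / (1 + 2 * c)"
    using tendsto_add[OF mean_dist_asymp[OF assms] err(1)] by simp
  show "\<forall>\<^sub>F n in sequentially. mean_dist n c / real n - drunk_error n / real n
      \<le> enn2real (dct (barbell n c)) / real n"
    using eventually_ge_at_top[of 2]
  proof eventually_elim
    case (elim n)
    have "mean_dist n c - drunk_error n \<le> enn2real (ennreal (mean_dist n c - drunk_error n))"
      by (cases "mean_dist n c - drunk_error n \<ge> 0") (simp_all add: ennreal_neg)
    also have "\<dots> \<le> enn2real (dct (barbell n c))"
      using dct_barbell_lower[OF elim] dct_barbell_finite[OF elim, of c] by (intro enn2real_mono) auto
    finally show ?case by (simp add: divide_right_mono flip: diff_divide_distrib)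
  qed
  show "\<forall>\<^sub>F n in sequentially. enn2real (dct (barbell n c)) / real n
      \<le> mean_dist n c / real n + (1 + drunk_error n) / real n"
    using eventually_ge_at_top[of 2]
  proof eventually_elim
    case (elim n)
    have "0 \<le> mean_dist n c + 1 + drunk_error n"
      by (auto simp: mean_dist_def drunk_error_def intro!: add_nonneg_nonneg divide_nonneg_nonneg sum_nonneg)
    then have "enn2real (dct (barbell n c)) \<le> mean_dist n c + 1 + drunk_error n"
      using dct_barbell_upper[OF elim, of c] by (intro enn2real_leI)
    then show ?case by (simp add: divide_right_mono add.assoc flip: add_divide_distrib)
  qed
qed

section \<open>The adversarial capture time and the quotient\<close>

lemma ct_barbell_asymp: "(\<lambda>n. enn2real (ennreal_of_enat (ct (barbell n c))) / real n) \<longlonglongrightarrow> 1 / 2"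
proof (rule tendsto_sandwich)
  have "(real n - 2) / 2 / real n \<le> enn2real (ennreal_of_enat (ct (barbell n c))) / real n \<and>
      enn2real (ennreal_of_enat (ct (barbell n c))) / real n \<le> (real n + 2) / 2 / real n"
    if n: "n \<ge> 2" for n
  proof -
    obtain k where k: "ct (barbell n c) = enat k" "n \<le> 2 * k + 2" "2 * k \<le> n + 2"
      using ct_barbell[OF n] by blast
    have "real n \<le> real (2 * k + 2)" "real (2 * k) \<le> real (n + 2)"
      using k(2,3) by (simp_all only: of_nat_le_iff)
    then have "(real n - 2) / 2 \<le> real k" "real k \<le> (real n + 2) / 2" by simp_all
    moreover have "enn2real (ennreal_of_enat (ct (barbell n c))) = real k"
      by (simp add: k(1) ennreal_of_nat_eq_real_of_nat)
    ultimately show ?thesis by (auto intro!: divide_right_mono simp del: divide_divide_eq_left)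
  qed
  note bounds = this
  show "\<forall>\<^sub>F n in sequentially. (real n - 2) / 2 / real n \<le> enn2real (ennreal_of_enat (ct (barbell n c))) / real n"
    by (rule eventually_mono[OF eventually_ge_at_top[of 2]]) (rule bounds[THEN conjunct1])
  show "\<forall>\<^sub>F n in sequentially. enn2real (ennreal_of_enat (ct (barbell n c))) / real n \<le> (real n + 2) / 2 / real n"
    by (rule eventually_mono[OF eventually_ge_at_top[of 2]]) (rule bounds[THEN conjunct2])
qed real_asymp+

theorem theorem4p1:
  fixes c :: real
  assumes "c \<ge> 0"
  shows "(\<lambda>n. enn2real (dct (barbell n c))) \<sim>[at_top]
           (\<lambda>n. real n / 2 * ((1 + 4 * c) / (2 + 4 * c))) \<and>
         (\<lambda>n. enn2real (cost_of_drunkenness (barbell n c))) \<longlonglongrightarrow> 1 + 1 / (1 + 4 * c)"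
proof
  let ?D = "\<lambda>n. enn2real (dct (barbell n c))" and ?C = "\<lambda>n. enn2real (ennreal_of_enat (ct (barbell n c)))"
  let ?l = "(1 / 4 + c) / (1 + 2 * c)"
  have l: "?l > 0" "?l = (1 + 4 * c) / (2 + 4 * c) / 2" using assms by (simp_all add: field_simps)
  from l(1) have l0: "?l \<noteq> 0" by (rule less_imp_neq[symmetric])
  note D = dct_barbell_asymp[OF assms]
  show "?D \<sim>[at_top] (\<lambda>n. real n / 2 * ((1 + 4 * c) / (2 + 4 * c)))"
  proof (rule asymp_equivI')
    have "(\<lambda>n. ?D n / real n / ?l) \<longlonglongrightarrow> ?l / ?l"
      by (rule tendsto_divide[OF D tendsto_const l0])
    moreover have "x / y / (q / 2) = x / (y / 2 * q)" for x y q :: real by simp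
    ultimately show "(\<lambda>n. ?D n / (real n / 2 * ((1 + 4 * c) / (2 + 4 * c)))) \<longlonglongrightarrow> 1"
      using divide_self[OF l0] by (simp only: l(2))
  qed
  have "(\<lambda>n. (?C n / real n) / (?D n / real n)) \<longlonglongrightarrow> (1 / 2) / ?l"
    by (rule tendsto_divide[OF ct_barbell_asymp D l0])
  also have "(1 / 2) / ?l = 1 + 1 / (1 + 4 * c)"
    using assms unfolding l(2) by (simp add: field_simps)
  finally have lim: "(\<lambda>n. (?C n / real n) / (?D n / real n)) \<longlonglongrightarrow> 1 + 1 / (1 + 4 * c)" .
  \<comment> \<open>The positive limit excludes \<open>dct = 0\<close> eventually, so the
    \<open>ennreal\<close> quotient is a quotient of reals and the factors 1 / n cancel.\<close>
  have "\<forall>\<^sub>F n in sequentially. ?D n / real n > 0"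
    using order_tendstoD(1)[OF D l(1)] .
  then have "\<forall>\<^sub>F n in sequentially. (?C n / real n) / (?D n / real n) = enn2real (cost_of_drunkenness (barbell n c))"
    using eventually_ge_at_top[of 2]
  proof eventually_elim
    case (elim n)
    then have pos: "?D n > 0" by (simp add: zero_less_divide_iff)
    obtain k where k: "ct (barbell n c) = enat k" using ct_barbell[OF elim(2)] by blast
    have "dct (barbell n c) = ennreal (?D n)"
      using dct_barbell_finite[OF elim(2), of c] by simp
    then have "cost_of_drunkenness (barbell n c) = ennreal (real k) / ennreal (?D n)"
      by (simp add: cost_of_drunkenness_def k ennreal_of_nat_eq_real_of_nat)
    also have "\<dots> = ennreal (real k / ?D n)" using pos by (intro divide_ennreal) auto
    finally show ?case using elim(2) pos by (simp add: k ennreal_of_nat_eq_real_of_nat)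
  qed
  then show "(\<lambda>n. enn2real (cost_of_drunkenness (barbell n c))) \<longlonglongrightarrow> 1 + 1 / (1 + 4 * c)"
    using lim by (rule Lim_transform_eventually[rotated])
qed

end
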